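(* Let $-\infty<\mu\le L<\infty$, let $x_i,g_i\in\mathbb{R}^d$ and $f_i\in\mathbb{R}$ for $i=1,\dots,N$, and set $X=(x_1\ \cdots\ x_N)\in\mathbb{R}^{d\times N}$ and $G=(g_1\ \cdots\ g_N)\in\mathbb{R}^{d\times N}$. The set of triplets $\{(x_i,g_i,f_i)\}_{i=1,\dots,N}$ is $\mathcal{Q}_{\mu,L}$-interpolable if, and only if, $$\begin{cases} X^TG=G^TX,\\ (G-\mu X)^T(LX-G)\succeq 0,\\ f_i=\frac12x_i^Tg_i,\quad\forall i\in\{1,\dots,N\}.\end{cases}$$
   Context: $\mathcal{Q}_{\mu,L}$ is the class of homogeneous quadratic functions $f(x)=\frac12x^TQx$ on $\mathbb{R}^d$, where $Q$ is a real symmetric matrix with $\mu I\preceq Q\preceq LI$. A set of triplets $\{(x_i,g_i,f_i)\}_{i=1,\dots,N}$ is $\mathcal{Q}_{\mu,L}$-interpolable if there exists $f\in\mathcal{Q}_{\mu,L}$ such that $f(x_i)=f_i$ and $\nabla f(x_i)=g_i$ for all $i\in\{1,\dots,N\}$. $\preceq$, $\succeq$ denote the Löwner order on symmetric matrices. *)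

theory Defs
  imports "HOL-Analysis.Analysis"
begin

definition symmetric_matrix :: "real^'n^'n \<Rightarrow> bool" where
  "symmetric_matrix A \<longleftrightarrow> transpose A = A"

text \<open>Positive semidefiniteness includes symmetry, since the Loewner order lives on symmetric
  matrices.\<close>

definition psd :: "real^'n^'n \<Rightarrow> bool" where
  "psd A \<longleftrightarrow> symmetric_matrix A \<and> (\<forall>v. 0 \<le> v \<bullet> (A *v v))"

definition loewner_le :: "real^'n^'n \<Rightarrow> real^'n^'n \<Rightarrow> bool" (infix \<open>\<preceq>\<^sub>L\<close> 50) where
  "A \<preceq>\<^sub>L B \<longleftrightarrow> psd (B - A)"

definition homogeneous_quadratics :: "real \<Rightarrow> real \<Rightarrow> (real^'d \<Rightarrow> real) set" where
  "homogeneous_quadratics \<mu> L =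
     {f. \<exists>Q :: real^'d^'d. symmetric_matrix Q \<and>
           \<mu> *\<^sub>R mat 1 \<preceq>\<^sub>L Q \<and> Q \<preceq>\<^sub>L L *\<^sub>R mat 1 \<and>
           (\<forall>x. f x = 1/2 * (x \<bullet> (Q *v x)))}"

definition quadratic_interpolable ::
    "real \<Rightarrow> real \<Rightarrow> ((real^'d) \<times> (real^'d) \<times> real) set \<Rightarrow> bool" where
  "quadratic_interpolable \<mu> L S \<longleftrightarrow>
     (\<exists>f \<in> homogeneous_quadratics \<mu> L.
        \<forall>(y, g, v) \<in> S. f y = v \<and> GDERIV f y :> g)"

text \<open>The matrix whose \<open>i\<close>-th column is \<open>x i\<close>; \<open>real^'n^'d\<close> is the type of matrices with
  rows indexed by \<open>'d\<close> and columns indexed by \<open>'n\<close>.\<close>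

definition matrix_of_columns :: "('n \<Rightarrow> real^'d) \<Rightarrow> real^'n^'d" where
  "matrix_of_columns x = (\<chi> k i. x i $ k)"

end

theory Submission
  imports Defs
begin

text \<open>Put \<open>\<kappa> = L - \<mu>\<close> and \<open>B = G - \<mu>X\<close>. The Loewner bounds \<open>0 \<preceq> A \<preceq> \<kappa>I\<close> on a symmetric
  matrix \<open>A = Q - \<mu>I\<close> amount to the single quadratic inequality \<open>\<bar>Aw\<bar>\<^sup>2 \<le> \<kappa> w \<bullet> Aw\<close>. On vectors
  \<open>w = Xu\<close> it becomes \<open>\<bar>Bu\<bar>\<^sup>2 \<le> \<kappa> Xu \<bullet> Bu\<close>, which is the matrix condition of the theorem.
  Conversely, if \<open>M = X\<^sup>TB\<close> is symmetric and this inequality holds, then \<open>A = B M\<^sup>+ B\<^sup>T\<close> is the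
  smallest positive semidefinite solution of \<open>AX = B\<close>, and it inherits the inequality.\<close>

section \<open>Symmetry and Loewner bounds in terms of inner products\<close>

lemma inner_vector_matrix_mult:
  fixes A :: "real^'n^'m"
  shows "u \<bullet> (v v* A) = (A *v u) \<bullet> v"
  by (metis dot_lmul_matrix inner_commute)

lemma symmetric_matrix_iff_inner:
  "symmetric_matrix A \<longleftrightarrow> (\<forall>u v. u \<bullet> (A *v v) = (A *v u) \<bullet> v)"
proof
  assume "symmetric_matrix A"
  then show "\<forall>u v. u \<bullet> (A *v v) = (A *v u) \<bullet> v"
    by (metis inner_vector_matrix_mult symmetric_matrix_def transpose_matrix_vector)
next
  assume "\<forall>u v. u \<bullet> (A *v v) = (A *v u) \<bullet> v"
  then have "u \<bullet> (transpose A *v v) = u \<bullet> (A *v v)" for u v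
    by (simp add: inner_vector_matrix_mult)
  then have "transpose A *v v = A *v v" for v
    using vector_eq_ldot by blast
  then show "symmetric_matrix A"
    by (simp add: symmetric_matrix_def matrix_eq)
qed

lemma scaled_mat_1_vector_mult [simp]: "(c *\<^sub>R mat 1 :: real^'n^'n) *v v = c *\<^sub>R v"
  by (simp flip: scaleR_matrix_vector_assoc)

lemma symmetric_scaled_mat_1: "symmetric_matrix (c *\<^sub>R mat 1)"
  by (simp add: symmetric_matrix_iff_inner)

lemma symmetric_matrix_diff:
  "symmetric_matrix A \<Longrightarrow> symmetric_matrix B \<Longrightarrow> symmetric_matrix (A - B)"
  by (simp add: symmetric_matrix_iff_inner matrix_vector_mult_diff_rdistrib inner_diff_left
      inner_diff_right)

text \<open>In an eigenbasis of \<open>A\<close>, both sides say that each eigenvalue t satisfies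
  t^2 <= \<kappa> t, that is, 0 <= t <= \<kappa>. The proof avoids diagonalisation.\<close>

lemma loewner_bounds_iff:
  fixes A :: "real^'n^'n"
  assumes "0 \<le> \<kappa>" and "symmetric_matrix A"
  shows "0 \<preceq>\<^sub>L A \<and> A \<preceq>\<^sub>L \<kappa> *\<^sub>R mat 1 \<longleftrightarrow> (\<forall>w. (A *v w) \<bullet> (A *v w) \<le> \<kappa> * (w \<bullet> (A *v w)))"
proof
  have sym: "u \<bullet> (A *v v) = (A *v u) \<bullet> v" for u v
    using assms(2) by (simp add: symmetric_matrix_iff_inner)
  assume "0 \<preceq>\<^sub>L A \<and> A \<preceq>\<^sub>L \<kappa> *\<^sub>R mat 1"
  then have pos: "0 \<le> v \<bullet> (A *v v)" and le: "v \<bullet> (A *v v) \<le> \<kappa> * (v \<bullet> v)" for v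
    by (auto simp: loewner_le_def psd_def matrix_vector_mult_diff_rdistrib inner_diff_right)
  show "\<forall>w. (A *v w) \<bullet> (A *v w) \<le> \<kappa> * (w \<bullet> (A *v w))"
  proof
    fix w
    define y where "y = A *v w"
    have wy: "w \<bullet> (A *v y) = y \<bullet> y"
      using sym[of w y] by (simp add: y_def)
    show "y \<bullet> y \<le> \<kappa> * (w \<bullet> y)"
    proof (cases "\<kappa> = 0")
      case True
      have zero: "v \<bullet> (A *v v) = 0" for v
        using pos[of v] le[of v] True by simp
      \<comment> \<open>The form vanishes identically, so its value at \<open>w + y\<close> leaves
        only the two cross terms, each equal to \<open>y \<bullet> y\<close>.\<close>
      have "y \<bullet> y = 0"
        using zero[of "w + y"] zero[of w] zero[of y] wy
        by (simp add: matrix_vector_right_distrib inner_add_left inner_add_right flip: y_def)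
      then show ?thesis using True by simp
    next
      case False
      define b where "b = \<kappa> *\<^sub>R w - y"
      have Ab: "A *v b = \<kappa> *\<^sub>R y - A *v y"
        by (simp add: b_def matrix_vector_mult_diff_distrib matrix_vector_mult_scaleR y_def)
      \<comment> \<open>With \<open>B = \<kappa>I - A\<close>: since \<open>A\<close>, \<open>B\<close> commute and sum to \<open>\<kappa>I\<close>, \<open>\<kappa>AB = ABA + BAB\<close>.\<close>
      have "\<kappa> * (\<kappa> * (w \<bullet> y) - y \<bullet> y) = (\<kappa> * (y \<bullet> y) - y \<bullet> (A *v y)) + b \<bullet> (A *v b)"
        unfolding Ab by (simp add: b_def inner_diff_left inner_diff_right wy algebra_simps)
      also have "\<dots> \<ge> 0"
        using le[of y] pos[of b] by simp
      finally show ?thesis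
        using False assms(1) by (simp add: zero_le_mult_iff)
    qed
  qed
next
  assume *: "\<forall>w. (A *v w) \<bullet> (A *v w) \<le> \<kappa> * (w \<bullet> (A *v w))"
  have pos: "0 \<le> w \<bullet> (A *v w)" for w
  proof (cases "\<kappa> = 0")
    case True
    with * have "A *v w = 0" by (metis inner_ge_zero inner_eq_zero_iff mult_zero_left order_antisym)
    then show ?thesis by simp
  next
    case False
    have "0 \<le> \<kappa> * (w \<bullet> (A *v w))"
      using * inner_ge_zero order_trans by blast
    then show ?thesis using False assms(1) by (simp add: zero_le_mult_iff)
  qed
  \<comment> \<open>By Cauchy-Schwarz |Aw|^2 <= \<kappa> |w| |Aw|. Cancelling |Aw| gives |Aw| <=
    \<kappa> |w|, and Cauchy-Schwarz again gives the upper bound.\<close>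
  have le: "w \<bullet> (A *v w) \<le> \<kappa> * (w \<bullet> w)" for w
  proof -
    have cs: "w \<bullet> (A *v w) \<le> norm w * norm (A *v w)"
      by (rule norm_cauchy_schwarz)
    have "norm (A *v w) * norm (A *v w) = (A *v w) \<bullet> (A *v w)"
      by (simp add: dot_square_norm power2_eq_square)
    also have "\<dots> \<le> \<kappa> * (w \<bullet> (A *v w))"
      using * by blast
    also have "\<dots> \<le> \<kappa> * (norm w * norm (A *v w))"
      using cs assms(1) by (rule mult_left_mono)
    finally have "norm (A *v w) \<le> \<kappa> * norm w"
      using assms(1) by (cases "norm (A *v w) = 0") (simp_all add: mult.assoc[symmetric])
    then have "norm w * norm (A *v w) \<le> \<kappa> * (w \<bullet> w)"
      using mult_left_mono[of "norm (A *v w)" "\<kappa> * norm w" "norm w"]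
      by (simp add: dot_square_norm power2_eq_square mult.left_commute)
    with cs show ?thesis by linarith
  qed
  show "0 \<preceq>\<^sub>L A \<and> A \<preceq>\<^sub>L \<kappa> *\<^sub>R mat 1"
    using pos le assms(2) symmetric_matrix_diff[OF symmetric_scaled_mat_1 assms(2)]
    by (auto simp: loewner_le_def psd_def matrix_vector_mult_diff_rdistrib inner_diff_right)
qed

section \<open>Symmetric solutions of AX = B\<close>

lemma symmetric_matrix_range:
  fixes M :: "real^'n^'n"
  assumes "symmetric_matrix M" and "\<And>u. M *v u = 0 \<Longrightarrow> u \<bullet> b = 0"
  shows "\<exists>w. M *v w = b"
proof -
  have sub: "subspace (range ((*v) M))"
    by (intro linear_subspace_image matrix_vector_mul_linear subspace_UNIV)
  \<comment> \<open>A subspace is its own double orthogonal complement, and for symmetric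
    \<open>M\<close> the complement of the range is the kernel.\<close>
  have "b \<in> (range ((*v) M))\<^sup>\<bottom>\<^sup>\<bottom>"
    unfolding orthogonal_comp_def orthogonal_def mem_Collect_eq
  proof (intro ballI)
    fix u assume "u \<in> {u. \<forall>y\<in>range ((*v) M). y \<bullet> u = 0}"
    then have "(M *v v) \<bullet> u = 0" for v by blast
    then have "v \<bullet> (M *v u) = 0" for v
      using assms(1) by (simp add: symmetric_matrix_iff_inner)
    then have "M *v u = 0" using inner_eq_zero_iff by blast
    then show "u \<bullet> b = 0" by (rule assms(2))
  qed
  then show ?thesis
    using orthogonal_comp_self[OF sub] by auto
qed

text \<open>No pseudoinverse is formed: v is sent to \<open>B *v s v\<close>, where
  \<open>s v\<close> is any solution of M s = B^T v. The choice does not matter because B vanishes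
  on the kernel of M.\<close>

lemma ex_symmetric_extension:
  fixes X B :: "real^'n^'d"
  assumes "0 \<le> \<kappa>"
    and sym: "\<And>u v. (X *v u) \<bullet> (B *v v) = (B *v u) \<bullet> (X *v v)"
    and le: "\<And>u. (B *v u) \<bullet> (B *v u) \<le> \<kappa> * ((X *v u) \<bullet> (B *v u))"
  shows "\<exists>A :: real^'d^'d. symmetric_matrix A \<and> A ** X = B \<and>
           (\<forall>w. (A *v w) \<bullet> (A *v w) \<le> \<kappa> * (w \<bullet> (A *v w)))"
proof -
  define M where "M = transpose X ** B"
  have M: "u \<bullet> (M *v v) = (X *v u) \<bullet> (B *v v)" for u v
    by (simp add: M_def inner_vector_matrix_mult flip: matrix_vector_mul_assoc)
  have symM: "symmetric_matrix M"
    unfolding symmetric_matrix_iff_inner by (metis M inner_commute sym)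
  have ker: "B *v u = 0" if "M *v u = 0" for u
    proof -
    have "(B *v u) \<bullet> (B *v u) \<le> 0"
      using le[of u] M[of u u] that by simp
    then show ?thesis by (metis inner_ge_zero inner_eq_zero_iff order_antisym)
  qed
  \<comment> \<open>B^T v is orthogonal to the kernel of \<open>M\<close>, since u . B^T v = Bu . v
    = 0 there.\<close>
  have "\<exists>w. M *v w = v v* B" for v
    by (rule symmetric_matrix_range[OF symM]) (simp add: inner_vector_matrix_mult ker)
  then obtain s where s: "\<And>v. M *v s v = v v* B"
    by metis
  \<comment> \<open>This makes \<open>p\<close> linear although the chosen \<open>s\<close> need not
    be.\<close>
  have eqI: "B *v u = B *v v" if "M *v u = M *v v" for u v
    using ker[of "u - v"] that by (simp add: matrix_vector_mult_diff_distrib)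
  define p where "p v = B *v s v" for v
  have "linear p"
  proof (rule linearI)
    show "p (u + v) = p u + p v" for u v
      unfolding p_def matrix_vector_right_distrib[symmetric]
      by (rule eqI) (simp only: s matrix_vector_right_distrib flip: transpose_matrix_vector)
    show "p (c *\<^sub>R v) = c *\<^sub>R p v" for c v
      unfolding p_def matrix_vector_mult_scaleR[symmetric]
      by (rule eqI) (simp only: s matrix_vector_mult_scaleR flip: transpose_matrix_vector)
  qed
  then have A: "matrix p *v v = p v" for v
    by (simp add: matrix_works)
  \<comment> \<open>This bilinear identity gives symmetry of \<open>p\<close>. On the diagonal, with
    \<open>p w = B *v s w\<close>, it turns the hypothesis \<open>le\<close> at \<open>s w\<close>
    into the required bound.\<close>
  have form: "u \<bullet> p v = (X *v s v) \<bullet> (B *v s u)" for u v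
  proof -
    have "u \<bullet> p v = s v \<bullet> (u v* B)"
      by (simp add: p_def inner_vector_matrix_mult inner_commute)
    then show ?thesis by (simp add: M flip: s)
  qed
  have "symmetric_matrix (matrix p)"
    unfolding symmetric_matrix_iff_inner A by (metis form inner_commute sym)
  moreover have "matrix p ** X = B"
  proof -
    \<comment> \<open>By symmetry B^T X = M, so \<open>u\<close> itself is an admissible preimage
      for \<open>X *v u\<close>.\<close>
    have "(X *v u) v* B = M *v u" for u
    proof -
      have "v \<bullet> ((X *v u) v* B) = v \<bullet> (M *v u)" for v
        by (simp add: inner_vector_matrix_mult M sym)
      then show ?thesis using vector_eq_ldot by blast
    qed
    then have "p (X *v u) = B *v u" for u
      unfolding p_def by (intro eqI) (simp add: s)
    then show ?thesis
      by (simp add: matrix_eq A flip: matrix_vector_mul_assoc)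
  qed
  moreover have "(p w) \<bullet> (p w) \<le> \<kappa> * (w \<bullet> p w)" for w
    using le[of "s w"] form[of w w] by (simp add: p_def)
  ultimately show ?thesis
    using A by auto
qed

section \<open>From interpolation to a matrix equation\<close>

lemma GDERIV_quadratic:
  fixes Q :: "real^'d^'d"
  assumes "symmetric_matrix Q"
  shows "GDERIV (\<lambda>x. 1/2 * (x \<bullet> (Q *v x))) y :> Q *v y"
  unfolding gderiv_def
proof (rule has_derivative_eq_rhs)
  show "((\<lambda>x. 1/2 * (x \<bullet> (Q *v x))) has_derivative
      (\<lambda>h. 1/2 * (y \<bullet> (Q *v h) + h \<bullet> (Q *v y)))) (at y)"
    by (intro derivative_intros bounded_linear_imp_has_derivative matrix_vector_mul_bounded_linear)
  show "(\<lambda>h. 1/2 * (y \<bullet> (Q *v h) + h \<bullet> (Q *v y))) = (\<lambda>h. h \<bullet> (Q *v y))"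
    using assms by (auto simp: symmetric_matrix_iff_inner inner_commute)
qed

lemma GDERIV_unique:
  assumes "GDERIV f x :> a" and "GDERIV f x :> b"
  shows "a = b"
  using has_derivative_unique[OF assms[unfolded gderiv_def]] vector_eq_ldot
  by (metis (full_types))

lemma mult_matrix_of_columns_eq_iff:
  fixes Q :: "real^'d^'d" and x g :: "'n::finite \<Rightarrow> real^'d"
  shows "Q ** matrix_of_columns x = matrix_of_columns g \<longleftrightarrow> (\<forall>i. Q *v x i = g i)"
  by (auto simp: matrix_of_columns_def matrix_matrix_mult_def matrix_vector_mult_def vec_eq_iff)

text \<open>The gradient at x is Qx, so the gradient data say QX = G. The function values are then
  forced, so the condition on \<open>f\<close> separates from the existence of
  \<open>Q\<close>.\<close>

lemma quadratic_interpolable_range_iff: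
  fixes x g :: "'n::finite \<Rightarrow> real^'d"
  shows "quadratic_interpolable \<mu> L (range (\<lambda>i. (x i, g i, f i))) \<longleftrightarrow>
    (\<exists>Q. symmetric_matrix Q \<and> \<mu> *\<^sub>R mat 1 \<preceq>\<^sub>L Q \<and> Q \<preceq>\<^sub>L L *\<^sub>R mat 1 \<and>
       Q ** matrix_of_columns x = matrix_of_columns g) \<and> (\<forall>i. f i = 1/2 * (x i \<bullet> g i))"
  (is "?lhs \<longleftrightarrow> (\<exists>Q. ?P Q) \<and> ?F")
proof
  assume ?lhs
  then obtain h where hq: "h \<in> homogeneous_quadratics \<mu> L"
    and interp: "\<And>i. h (x i) = f i" "\<And>i. GDERIV h (x i) :> g i"
    unfolding quadratic_interpolable_def by auto
  from hq obtain Q where Q: "symmetric_matrix Q" "\<mu> *\<^sub>R mat 1 \<preceq>\<^sub>L Q" "Q \<preceq>\<^sub>L L *\<^sub>R mat 1"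
    and h: "h = (\<lambda>x. 1/2 * (x \<bullet> (Q *v x)))"
    unfolding homogeneous_quadratics_def by blast
  have g: "Q *v x i = g i" for i
    using GDERIV_unique GDERIV_quadratic[OF Q(1)] interp(2) unfolding h by blast
  then have "?P Q"
    using Q by (simp add: mult_matrix_of_columns_eq_iff)
  moreover have ?F
    using interp(1) g by (simp add: h flip: interp(1))
  ultimately show "(\<exists>Q. ?P Q) \<and> ?F" by blast
next
  assume "(\<exists>Q. ?P Q) \<and> ?F"
  then obtain Q where Q: "?P Q" and ?F by blast
  then have g: "Q *v x i = g i" for i
    by (simp add: mult_matrix_of_columns_eq_iff)
  let ?h = "\<lambda>x. 1/2 * (x \<bullet> (Q *v x))"
  have "?h \<in> homogeneous_quadratics \<mu> L"
    using Q unfolding homogeneous_quadratics_def by blast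
  moreover have "?h (x i) = f i \<and> GDERIV ?h (x i) :> g i" for i
    using GDERIV_quadratic[of Q "x i"] Q \<open>?F\<close> by (simp add: g)
  ultimately show ?lhs
    unfolding quadratic_interpolable_def by (intro bexI[of _ ?h]) auto
qed

text \<open>Necessity evaluates symmetry and the quadratic inequality of \<open>A\<close> on the
  range of \<open>X\<close>; sufficiency is the extension lemma.\<close>

lemma ex_loewner_bounded_iff:
  fixes X B :: "real^'n^'d"
  assumes "0 \<le> \<kappa>"
  shows "(\<exists>A. symmetric_matrix A \<and> 0 \<preceq>\<^sub>L A \<and> A \<preceq>\<^sub>L \<kappa> *\<^sub>R mat 1 \<and> A ** X = B) \<longleftrightarrow>
    (\<forall>u v. (X *v u) \<bullet> (B *v v) = (B *v u) \<bullet> (X *v v)) \<and>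
    (\<forall>u. (B *v u) \<bullet> (B *v u) \<le> \<kappa> * ((X *v u) \<bullet> (B *v u)))"
  (is "?lhs \<longleftrightarrow> ?rhs")
proof
  assume ?lhs
  then obtain A where A: "symmetric_matrix A" "0 \<preceq>\<^sub>L A" "A \<preceq>\<^sub>L \<kappa> *\<^sub>R mat 1" and "A ** X = B"
    by blast
  then have "B *v u = A *v (X *v u)" for u
    by (simp add: matrix_vector_mul_assoc)
  then show ?rhs
    using A loewner_bounds_iff[OF assms A(1)] by (simp add: symmetric_matrix_iff_inner)
next
  assume ?rhs
  then show ?lhs
    using ex_symmetric_extension[OF assms, of X B] loewner_bounds_iff[OF assms] by metis
qed

theorem theorem3p7:
  fixes \<mu> L :: real
    and x g :: "'n::finite \<Rightarrow> real^'d"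
    and f :: "'n \<Rightarrow> real"
    and X G :: "real^'n^'d"
  assumes "\<mu> \<le> L"
    and "X = matrix_of_columns x"
    and "G = matrix_of_columns g"
  shows "quadratic_interpolable \<mu> L (range (\<lambda>i. (x i, g i, f i))) \<longleftrightarrow>
           transpose X ** G = transpose G ** X \<and>
           0 \<preceq>\<^sub>L transpose (G - \<mu> *\<^sub>R X) ** (L *\<^sub>R X - G) \<and>
           (\<forall>i. f i = 1/2 * (x i \<bullet> g i))"
proof -
  define B where "B = G - \<mu> *\<^sub>R X"
  define C where "C = transpose B ** (L *\<^sub>R X - G)"
  have Bv: "B *v u = G *v u - \<mu> *\<^sub>R (X *v u)" for u
    by (simp add: B_def matrix_vector_mult_diff_rdistrib flip: scaleR_matrix_vector_assoc)
  \<comment> \<open>Rewriting LX - G as (L - \<mu>)X - B expresses C through X and B alone.\<close>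
  have Cv: "u \<bullet> (C *v v) = (B *v u) \<bullet> ((L - \<mu>) *\<^sub>R (X *v v) - B *v v)" for u v
  proof -
    have "(L *\<^sub>R X - G) *v v = (L - \<mu>) *\<^sub>R (X *v v) - B *v v"
      by (simp add: Bv matrix_vector_mult_diff_rdistrib algebra_simps
          flip: scaleR_matrix_vector_assoc)
    then show ?thesis
      by (simp add: C_def inner_vector_matrix_mult flip: matrix_vector_mul_assoc)
  qed
  have shift: "(\<exists>Q. symmetric_matrix Q \<and> \<mu> *\<^sub>R mat 1 \<preceq>\<^sub>L Q \<and> Q \<preceq>\<^sub>L L *\<^sub>R mat 1 \<and> Q ** X = G) \<longleftrightarrow>
      (\<exists>A. symmetric_matrix A \<and> 0 \<preceq>\<^sub>L A \<and> A \<preceq>\<^sub>L (L - \<mu>) *\<^sub>R mat 1 \<and> A ** X = B)"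
    (is "(\<exists>Q. ?P Q) \<longleftrightarrow> (\<exists>A. ?R A)")
  proof -
    have P: "?P Q \<longleftrightarrow> ?R (Q - \<mu> *\<^sub>R mat 1)" for Q
    proof -
      have "symmetric_matrix Q \<longleftrightarrow> symmetric_matrix (Q - \<mu> *\<^sub>R mat 1)"
        by (auto simp: symmetric_matrix_iff_inner matrix_vector_mult_diff_rdistrib inner_diff_left
            inner_diff_right)
      moreover have "Q ** X = G \<longleftrightarrow> (Q - \<mu> *\<^sub>R mat 1) ** X = B"
        by (simp add: matrix_eq Bv matrix_vector_mult_diff_rdistrib flip: matrix_vector_mul_assoc)
      ultimately show ?thesis
        by (simp add: loewner_le_def algebra_simps)
    qed
    show ?thesis
      unfolding P by (metis add_diff_cancel_right')
  qed
  \<comment> \<open>X^T B and X^T G differ by the symmetric matrix \<mu> X^T X.\<close>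
  have sym: "transpose X ** G = transpose G ** X \<longleftrightarrow>
      (\<forall>u v. (X *v u) \<bullet> (B *v v) = (B *v u) \<bullet> (X *v v))"
  proof -
    have "transpose X ** G = transpose G ** X \<longleftrightarrow>
        (\<forall>v u. u \<bullet> ((transpose X ** G) *v v) = u \<bullet> ((transpose G ** X) *v v))"
      by (simp add: matrix_eq vector_eq_ldot)
    also have "\<dots> \<longleftrightarrow> (\<forall>u v. (X *v u) \<bullet> (B *v v) = (B *v u) \<bullet> (X *v v))"
      by (auto simp: inner_vector_matrix_mult Bv inner_diff_left inner_diff_right
          simp flip: matrix_vector_mul_assoc)
    finally show ?thesis .
  qed
  \<comment> \<open>C = (L - \<mu>) B^T X - B^T B inherits symmetry from X^T B, which is why the
    equivalence is conditional; only the sign of the quadratic form remains.\<close>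
  have psd: "0 \<preceq>\<^sub>L C \<longleftrightarrow> (\<forall>u. (B *v u) \<bullet> (B *v u) \<le> (L - \<mu>) * ((X *v u) \<bullet> (B *v u)))"
    if "\<forall>u v. (X *v u) \<bullet> (B *v v) = (B *v u) \<bullet> (X *v v)"
  proof -
    have "u \<bullet> (C *v v) = (C *v u) \<bullet> v" for u v
    proof -
      have "u \<bullet> (C *v v) = v \<bullet> (C *v u)"
        unfolding Cv inner_diff_right inner_scaleR_right by (metis inner_commute that)
      then show ?thesis by (simp add: inner_commute)
    qed
    then have "symmetric_matrix C"
      by (simp add: symmetric_matrix_iff_inner)
    then show ?thesis
      by (simp add: loewner_le_def psd_def Cv inner_diff_right inner_commute)
  qed
  have "0 \<le> L - \<mu>"
    using assms(1) by simp
  from ex_loewner_bounded_iff[OF this, of X B] sym psd shift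
  show ?thesis
    unfolding quadratic_interpolable_range_iff assms(2,3)[symmetric] B_def[symmetric]
      C_def[symmetric] by blast
qed

end
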